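(* There is no topological half-ribbon element $t$ for $(U_q(\mathfrak{sl}_2),R)$, where $R$ is the standard $R$-matrix, such that $t^{-2}$ is the usual ribbon element $C$. That is, there is no invertible $t\in\widetilde{U_q(\mathfrak{sl}_2)}$ such that $(t^{-1}\otimes t^{-1})\Delta(t)=R$ and $t^{-2}=C$.
   Context: **Conventions.** $U_q(\mathfrak{sl}_2)$ is the quantized enveloping algebra with generators $E,F,K^{\pm1}$ over $\mathbb C(q)$ with a suitable fixed $k$-th root of $q$ adjoined; $KEK^{-1}=q^2E$, $KFK^{-1}=q^{-2}F$, $[E,F]=(K-K^{-1})/(q-q^{-1})$, $\Delta E=E\otimes K+1\otimes E$, $\Delta F=F\otimes1+K^{-1}\otimes F$, $\Delta K=K\otimes K$. Representations are finite-dimensional of Type 1; $V_\lambda$ is the irreducible one of highest weight $\lambda$. Write $(\cdot,\cdot)$ for the usual form on weights, with $(\alpha,\alpha)=2$, and $\rho=\alpha/2$. $\widetilde{U_q(\mathfrak{sl}_2)}=\prod_\lambda\mathrm{End}(V_\lambda)$ is the completion by matrix elements of representations, and similarly for the tensor square (using all $V_\lambda\otimes V_\mu$); the structure maps extend. **Standard $R$ and $C$.** $T$ acts on a weight vector $v$ with $Kv=q^nv$ by $T(v)=\sum_{a,b,c\ge0,\,-a+b-c=n}(-1)^bq^{\,b-ac}E^{(a)}F^{(b)}E^{(c)}v$; $J$ acts on a weight vector $v$ by $q^{(\mathrm{wt}(v),\mathrm{wt}(v))/2+(\mathrm{wt}(v),\rho)}$; $X=JT$. The standard universal $R$-matrix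 is $R=(X^{-1}\otimes X^{-1})\Delta(X)$ (by a theorem of Kirillov–Reshetikhin and Levendorskii–Soibelman, taken as its definition). $C$ is the element of $\widetilde{U_q(\mathfrak{sl}_2)}$ acting on $V_\lambda$ by $q^{-(\lambda,\lambda)-2(\lambda,\rho)}$. It is known that $(U_q(\mathfrak{sl}_2),R,C)$ is a topological ribbon Hopf algebra. **Half-ribbon element.** A topological half-ribbon element for $(\mathcal H,R)$ is an invertible $t$ in the completion of $\mathcal H$ such that $(t^{-1}\otimes t^{-1})\Delta(t)=R$ and $(\mathcal H,R,t^{-2})$ is a topological ribbon Hopf algebra. *)

theory Defs
  imports
    "HOL-Computational_Algebra.Polynomial"
    "HOL-Computational_Algebra.Fraction_Field"
    "Jordan_Normal_Form.Matrix"
begin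

section \<open>The ground field\<close>

text \<open>
  Adjoining a \<open>k\<close>-th root \<open>s\<close> of \<open>q\<close> to the field of rational functions in \<open>q\<close> over the complex
  numbers gives the field of rational functions in \<open>s\<close>, with \<open>q = s ^ k\<close>. The rational powers of
  \<open>q\<close> that occur below have exponents in a quarter of the integers, so the suitable \<open>k\<close> are the
  positive multiples of 4.
\<close>

type_synonym scalar = "complex poly fract"

definition qroot :: scalar where
  "qroot = Fract [:0, 1:] 1"

text \<open>\<open>qpow k r\<close> is \<open>q\<close> to the power \<open>r\<close>; it is used only for \<open>r\<close> with \<open>k * r\<close> an integer, where
  the floor does nothing.\<close>

definition qpow :: "nat \<Rightarrow> rat \<Rightarrow> scalar" where
  "qpow k r = qroot powi \<lfloor>of_nat k * r\<rfloor>"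

abbreviation qq :: "nat \<Rightarrow> scalar" where
  "qq k \<equiv> qroot ^ k"

definition qint :: "nat \<Rightarrow> int \<Rightarrow> scalar" where
  "qint k n = (qq k powi n - qq k powi (- n)) / (qq k - inverse (qq k))"

definition qfact :: "nat \<Rightarrow> nat \<Rightarrow> scalar" where
  "qfact k n = (\<Prod>i = 1..n. qint k (int i))"

text \<open>A weight \<open>m * \<alpha> / 2\<close> is encoded by the integer \<open>m\<close>, so that \<open>\<alpha>\<close> is 2 and \<open>\<rho>\<close> is 1; the form is
  normalised by \<open>(\<alpha>, \<alpha>) = 2\<close>.\<close>

definition wt_form :: "int \<Rightarrow> int \<Rightarrow> rat" where
  "wt_form m n = of_int (m * n) / 2"

definition rho :: int where
  "rho = 1"


section \<open>Finite-dimensional representations\<close>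

definition kron :: "scalar mat \<Rightarrow> scalar mat \<Rightarrow> scalar mat" where
  "kron A B = mat (dim_row A * dim_row B) (dim_col A * dim_col B)
     (\<lambda>(i, j). A $$ (i div dim_row B, j div dim_col B) * B $$ (i mod dim_row B, j mod dim_col B))"

record uq_module =
  rdim :: nat
  opE :: "scalar mat"
  opF :: "scalar mat"
  opK :: "scalar mat"
  opKinv :: "scalar mat"

definition is_uq_module :: "nat \<Rightarrow> uq_module \<Rightarrow> bool" where
  "is_uq_module k M \<longleftrightarrow>
     opE M \<in> carrier_mat (rdim M) (rdim M) \<and> opF M \<in> carrier_mat (rdim M) (rdim M) \<and>
     opK M \<in> carrier_mat (rdim M) (rdim M) \<and> opKinv M \<in> carrier_mat (rdim M) (rdim M) \<and>
     opK M * opKinv M = 1\<^sub>m (rdim M) \<and> opKinv M * opK M = 1\<^sub>m (rdim M) \<and>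
     opK M * opE M * opKinv M = qq k ^ 2 \<cdot>\<^sub>m opE M \<and>
     opK M * opF M * opKinv M = inverse (qq k ^ 2) \<cdot>\<^sub>m opF M \<and>
     opE M * opF M - opF M * opE M
       = inverse (qq k - inverse (qq k)) \<cdot>\<^sub>m (opK M - opKinv M)"

definition intertwiner :: "uq_module \<Rightarrow> uq_module \<Rightarrow> scalar mat \<Rightarrow> bool" where
  "intertwiner M N f \<longleftrightarrow> f \<in> carrier_mat (rdim N) (rdim M) \<and>
     f * opE M = opE N * f \<and> f * opF M = opF N * f \<and>
     f * opK M = opK N * f \<and> f * opKinv M = opKinv N * f"

text \<open>The tensor product, through \<open>\<Delta>E = E \<otimes> K + 1 \<otimes> E\<close>, \<open>\<Delta>F = F \<otimes> 1 + K\<^sup>-\<^sup>1 \<otimes> F\<close>, \<open>\<Delta>K = K \<otimes> K\<close>.\<close>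

definition tensor_module :: "uq_module \<Rightarrow> uq_module \<Rightarrow> uq_module" where
  "tensor_module M N = \<lparr>
     rdim = rdim M * rdim N,
     opE = kron (opE M) (opK N) + kron (1\<^sub>m (rdim M)) (opE N),
     opF = kron (opF M) (1\<^sub>m (rdim N)) + kron (opKinv M) (opF N),
     opK = kron (opK M) (opK N),
     opKinv = kron (opKinv M) (opKinv N)\<rparr>"

text \<open>The irreducible module of highest weight \<open>n\<close>, on its basis \<open>v\<^sub>i = F\<^sup>(\<^sup>i\<^sup>) v\<^sub>0\<close> for \<open>0 \<le> i \<le> n\<close>:
  \<open>E v\<^sub>i = [n - i + 1] v\<^sub>i\<^sub>-\<^sub>1\<close>, \<open>F v\<^sub>i = [i + 1] v\<^sub>i\<^sub>+\<^sub>1\<close>, \<open>K v\<^sub>i = q\<^sup>n\<^sup>-\<^sup>2\<^sup>i v\<^sub>i\<close>.\<close>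

definition Vmod :: "nat \<Rightarrow> nat \<Rightarrow> uq_module" where
  "Vmod k n = \<lparr>
     rdim = n + 1,
     opE = mat (n + 1) (n + 1) (\<lambda>(i, j). if j = i + 1 then qint k (int n - int j + 1) else 0),
     opF = mat (n + 1) (n + 1) (\<lambda>(i, j). if i = j + 1 then qint k (int j + 1) else 0),
     opK = mat (n + 1) (n + 1) (\<lambda>(i, j). if i = j then qq k powi (int n - 2 * int i) else 0),
     opKinv = mat (n + 1) (n + 1) (\<lambda>(i, j). if i = j then qq k powi - (int n - 2 * int i) else 0)\<rparr>"


section \<open>The completions\<close>

text \<open>
  An element of the completion is a family \<open>x\<close> with \<open>x n\<close> in \<open>End V\<^sub>n\<close>, and an element of the
  completed tensor square is a family \<open>y\<close> with \<open>y m n\<close> in \<open>End (V\<^sub>m \<otimes> V\<^sub>n)\<close>; all operations except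
  the coproduct are componentwise. The unit group of a product of rings is the product of the unit
  groups, so invertibility and inverses are componentwise as well.
\<close>

type_synonym uhat = "nat \<Rightarrow> scalar mat"
type_synonym uhat2 = "nat \<Rightarrow> nat \<Rightarrow> scalar mat"

definition End_V :: "nat \<Rightarrow> scalar mat ring" where
  "End_V n = ring_mat TYPE(scalar) (n + 1) ()"

definition uhat_mult :: "uhat \<Rightarrow> uhat \<Rightarrow> uhat" where
  "uhat_mult x y = (\<lambda>n. x n * y n)"

definition uhat_units :: "uhat set" where
  "uhat_units = {x. \<forall>n. x n \<in> Units (End_V n)}"

definition uhat_inv :: "uhat \<Rightarrow> uhat" where
  "uhat_inv x = (\<lambda>n. inv\<^bsub>End_V n\<^esub> (x n))"

definition uhat2_mult :: "uhat2 \<Rightarrow> uhat2 \<Rightarrow> uhat2" where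
  "uhat2_mult x y = (\<lambda>m n. x m n * y m n)"

definition uhat_tensor :: "uhat \<Rightarrow> uhat \<Rightarrow> uhat2" where
  "uhat_tensor x y = (\<lambda>m n. kron (x m) (y n))"

text \<open>
  The action of \<open>x\<close> in the completion on a finite-dimensional type 1 module \<open>M\<close>. As \<open>M\<close> is a direct
  sum of modules \<open>V\<^sub>n\<close>, there is exactly one operator on \<open>M\<close> that restricts to \<open>x n\<close> along every
  homomorphism from \<open>V\<^sub>n\<close> to \<open>M\<close>.
\<close>

definition act :: "nat \<Rightarrow> uhat \<Rightarrow> uq_module \<Rightarrow> scalar mat" where
  "act k x M = (THE A. A \<in> carrier_mat (rdim M) (rdim M) \<and>
     (\<forall>n f. intertwiner (Vmod k n) M f \<longrightarrow> A * f = f * x n))"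

definition coprod :: "nat \<Rightarrow> uhat \<Rightarrow> uhat2" where
  "coprod k x = (\<lambda>m n. act k x (tensor_module (Vmod k m) (Vmod k n)))"


section \<open>The standard R-matrix and ribbon element\<close>

definition divpow :: "nat \<Rightarrow> scalar mat \<Rightarrow> nat \<Rightarrow> scalar mat" where
  "divpow k A a = inverse (qfact k a) \<cdot>\<^sub>m (A ^\<^sub>m a)"

text \<open>Column \<open>j\<close> of \<open>T\<close> is the image of the weight vector \<open>v\<^sub>j\<close>, whose weight is \<open>n - 2 * j\<close>. Cutting
  the exponents off at \<open>n\<close> loses nothing: see \<open>divpow_E_eq_0\<close> and \<open>divpow_F_eq_0\<close> below.\<close>

definition T_elt :: "nat \<Rightarrow> uhat" where
  "T_elt k = (\<lambda>n. mat (n + 1) (n + 1) (\<lambda>(i, j).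
     \<Sum>(a, b, c) | a \<le> n \<and> b \<le> n \<and> c \<le> n \<and> - int a + int b - int c = int n - 2 * int j.
       (- 1) ^ b * qq k powi (int b - int a * int c) *
       (divpow k (opE (Vmod k n)) a * divpow k (opF (Vmod k n)) b * divpow k (opE (Vmod k n)) c)
         $$ (i, j)))"

definition J_elt :: "nat \<Rightarrow> uhat" where
  "J_elt k = (\<lambda>n. mat (n + 1) (n + 1) (\<lambda>(i, j).
     if i = j then (let w = int n - 2 * int j in qpow k (wt_form w w / 2 + wt_form w rho)) else 0))"

definition X_elt :: "nat \<Rightarrow> uhat" where
  "X_elt k = uhat_mult (J_elt k) (T_elt k)"

definition R_elt :: "nat \<Rightarrow> uhat2" where
  "R_elt k = uhat2_mult (uhat_tensor (uhat_inv (X_elt k)) (uhat_inv (X_elt k))) (coprod k (X_elt k))"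

definition C_elt :: "nat \<Rightarrow> uhat" where
  "C_elt k = (\<lambda>n. qpow k (- wt_form (int n) (int n) - 2 * wt_form (int n) rho) \<cdot>\<^sub>m 1\<^sub>m (n + 1))"


section \<open>Consistency of the definitions\<close>


lemma qroot_power: "qroot ^ n = Fract (monom 1 n) 1"
  by (induction n) (simp_all add: qroot_def One_fract_def monom_Suc)

lemma qroot_neq_0 [simp]: "qroot \<noteq> 0"
  by (simp add: qroot_def Zero_fract_def eq_fract)

lemma qroot_power_neq_1: "n > 0 \<Longrightarrow> qroot ^ n \<noteq> 1"
proof
  assume "n > 0" "qroot ^ n = 1"
  then have "monom (1::complex) n = 1"
    by (simp add: qroot_power One_fract_def eq_fract)
  then have "degree (monom (1::complex) n) = 0"
    by simp
  with \<open>n > 0\<close> show False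
    by (simp add: degree_monom_eq)
qed

lemma qint_nonzero: "k > 0 \<Longrightarrow> n > 0 \<Longrightarrow> qint k (int n) \<noteq> 0"
proof -
  assume k: "k > 0" and n: "n > 0"
  have *: "qq k ^ m - inverse (qq k ^ m) \<noteq> 0" if "m > 0" for m
  proof
    assume "qq k ^ m - inverse (qq k ^ m) = 0"
    then have "qq k ^ m * qq k ^ m = 1"
      by (simp add: field_simps)
    then have "qroot ^ (k * m + k * m) = 1"
      by (simp add: power_mult power_add)
    with qroot_power_neq_1[of "k * m + k * m"] k that show False
      by simp
  qed
  from *[OF n] *[of 1] show ?thesis
    by (simp add: qint_def power_int_minus)
qed

lemma q_minus_inverse_nonzero:
  assumes "k > 0"
  shows "qq k - inverse (qq k) \<noteq> 0"
  using qint_nonzero[OF assms, of 1] by (auto simp: qint_def)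

lemma qint_0 [simp]: "qint k 0 = 0"
  by (simp add: qint_def)

lemma qint_identity:
  assumes "k > 0"
  shows "qint k (a + 1) * qint k b - qint k (b + 1) * qint k a = qint k (b - a)"
proof -
  define x y z d where "x = qq k powi a" and "y = qq k powi b" and "z = qq k"
    and "d = qq k - inverse (qq k)"
  have nz: "x \<noteq> 0" "y \<noteq> 0" "z \<noteq> 0"
    by (auto simp: x_def y_def z_def)
  have d: "d \<noteq> 0" "d = z - inverse z"
    using q_minus_inverse_nonzero[OF assms] by (auto simp: d_def z_def)
  have q: "qint k a = (x - inverse x) / d" "qint k b = (y - inverse y) / d"
    "qint k (a + 1) = (x * z - inverse (x * z)) / d"
    "qint k (b + 1) = (y * z - inverse (y * z)) / d"
    "qint k (b - a) = (y / x - x / y) / d"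
    by (simp_all add: qint_def x_def y_def z_def d_def power_int_minus power_int_add
        power_int_diff divide_inverse mult.commute)
  have "((x * z - inverse (x * z)) * (y - inverse y) - (y * z - inverse (y * z)) * (x - inverse x))
      = (y / x - x / y) * d"
    using nz unfolding d(2) by (simp add: field_simps)
  then show ?thesis
    using d(1) unfolding q by (simp add: divide_simps) 
qed

lemma diag_mult:
  fixes d :: "nat \<Rightarrow> scalar"
  shows "mat n n (\<lambda>(i, j). if i = j then d i else 0) * mat n n g = mat n n (\<lambda>(i, j). d i * g (i, j))"
    and "mat n n g * mat n n (\<lambda>(i, j). if i = j then d i else 0) = mat n n (\<lambda>(i, j). g (i, j) * d j)"
  by (rule eq_matI; simp add: scalar_prod_def if_distrib[of "\<lambda>x. x * _"] if_distrib[of "\<lambda>x. _ * x"]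
      sum.delta cong: if_cong)+

lemma Vmod_is_uq_module:
  assumes "k > 0"
  shows "is_uq_module k (Vmod k n)"
proof -
  have E_F: "opE (Vmod k n) * opF (Vmod k n) = mat (n + 1) (n + 1)
     (\<lambda>(i, j). if i = j then qint k (int i + 1) * qint k (int n - int i) else 0)"
  proof (rule eq_matI)
    fix i j assume "i < dim_row (mat (n + 1) (n + 1)
       (\<lambda>(i, j). if i = j then qint k (int i + 1) * qint k (int n - int i) else 0))"
      "j < dim_col (mat (n + 1) (n + 1)
       (\<lambda>(i, j). if i = j then qint k (int i + 1) * qint k (int n - int i) else 0))"
    then have ij: "i < n + 1" "j < n + 1" by auto
    have "(opE (Vmod k n) * opF (Vmod k n)) $$ (i, j)
        = (\<Sum>l = 0..<n + 1. opE (Vmod k n) $$ (i, l) * opF (Vmod k n) $$ (l, j))"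
      using ij by (simp add: Vmod_def scalar_prod_def del: sum.op_ivl_Suc)
    also have "\<dots> = (\<Sum>l = 0..<n + 1.
       if l = i + 1 then (if i = j then qint k (int n - int i) * qint k (int i + 1) else 0) else 0)"
      using ij by (intro sum.cong refl) (auto simp: Vmod_def)
    also have "\<dots> = (if i = j then qint k (int i + 1) * qint k (int n - int i) else 0)"
      using ij by (cases "i = n") auto
    finally show "(opE (Vmod k n) * opF (Vmod k n)) $$ (i, j) = mat (n + 1) (n + 1)
      (\<lambda>(i, j). if i = j then qint k (int i + 1) * qint k (int n - int i) else 0) $$ (i, j)"
      using ij by simp
  qed (simp_all add: Vmod_def)
  have F_E: "opF (Vmod k n) * opE (Vmod k n) = mat (n + 1) (n + 1)
     (\<lambda>(i, j). if i = j then qint k (int n - int i + 1) * qint k (int i) else 0)"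
  proof (rule eq_matI)
    fix i j assume "i < dim_row (mat (n + 1) (n + 1)
       (\<lambda>(i, j). if i = j then qint k (int n - int i + 1) * qint k (int i) else 0))"
      "j < dim_col (mat (n + 1) (n + 1)
       (\<lambda>(i, j). if i = j then qint k (int n - int i + 1) * qint k (int i) else 0))"
    then have ij: "i < n + 1" "j < n + 1" by auto
    have "(opF (Vmod k n) * opE (Vmod k n)) $$ (i, j)
        = (\<Sum>l = 0..<n + 1. opF (Vmod k n) $$ (i, l) * opE (Vmod k n) $$ (l, j))"
      using ij by (simp add: Vmod_def scalar_prod_def del: sum.op_ivl_Suc)
    also have "\<dots> = (\<Sum>l = 0..<n + 1.
       if l = i - 1 then (if i = j then qint k (int n - int i + 1) * qint k (int i) else 0) else 0)"
      using ij by (intro sum.cong refl) (cases "i = 0"; auto simp: Vmod_def add.commute)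
    also have "\<dots> = (if i = j then qint k (int n - int i + 1) * qint k (int i) else 0)"
      using ij by auto
    finally show "(opF (Vmod k n) * opE (Vmod k n)) $$ (i, j) = mat (n + 1) (n + 1)
      (\<lambda>(i, j). if i = j then qint k (int n - int i + 1) * qint k (int i) else 0) $$ (i, j)"
      using ij by simp
  qed (simp_all add: Vmod_def)
  have nz: "qq k \<noteq> 0"
    by simp
  have Kinv: "opK (Vmod k n) * opKinv (Vmod k n) = 1\<^sub>m (n + 1)"
    "opKinv (Vmod k n) * opK (Vmod k n) = 1\<^sub>m (n + 1)"
    unfolding Vmod_def uq_module.simps diag_mult
    by (auto intro!: eq_matI simp: power_int_minus simp del: minus_diff_eq)
  have shift: "qq k powi a * x * qq k powi (- b) = qq k powi (a - b) * x" for a b x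
    using nz by (simp add: power_int_diff power_int_minus field_simps)
  have KE: "opK (Vmod k n) * opE (Vmod k n) * opKinv (Vmod k n) = qq k ^ 2 \<cdot>\<^sub>m opE (Vmod k n)"
    unfolding Vmod_def uq_module.simps diag_mult
    by (auto intro!: eq_matI simp: shift simp del: minus_diff_eq)
  have shift2: "qq k powi (int n - (2 + 2 * int j)) * qq k powi (- (int n - 2 * int j))
      = inverse (qq k ^ 2)" for j
    using shift[of "int n - 2 * int j - 2" 1 "int n - 2 * int j"]
    by (simp add: power_int_minus algebra_simps)
  have KF: "opK (Vmod k n) * opF (Vmod k n) * opKinv (Vmod k n)
     = inverse (qq k ^ 2) \<cdot>\<^sub>m opF (Vmod k n)"
    unfolding Vmod_def uq_module.simps diag_mult
    by (rule eq_matI)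
      (auto simp: shift2 simp del: minus_diff_eq)
  have qi: "qint k (int i + 1) * qint k (int n - int i) - qint k (int n - int i + 1) * qint k (int i)
      = inverse (qq k - inverse (qq k)) *
        (qq k powi (int n - 2 * int i) - qq k powi (- (int n - 2 * int i)))" for i
  proof -
    have *: "int n - int i - int i = int n - 2 * int i" by simp
    show ?thesis
      unfolding qint_identity[OF assms] * qint_def[of k "int n - 2 * int i"]
      by (simp only: divide_inverse mult.commute)
  qed
  have comm: "opE (Vmod k n) * opF (Vmod k n) - opF (Vmod k n) * opE (Vmod k n)
     = inverse (qq k - inverse (qq k)) \<cdot>\<^sub>m (opK (Vmod k n) - opKinv (Vmod k n))"
    unfolding E_F F_E by (rule eq_matI) (auto simp: Vmod_def qi simp del: minus_diff_eq)
  have dim: "rdim (Vmod k n) = n + 1"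
    by (simp add: Vmod_def)
  have "opE (Vmod k n) \<in> carrier_mat (n + 1) (n + 1)" "opF (Vmod k n) \<in> carrier_mat (n + 1) (n + 1)"
    "opK (Vmod k n) \<in> carrier_mat (n + 1) (n + 1)" "opKinv (Vmod k n) \<in> carrier_mat (n + 1) (n + 1)"
    by (simp_all add: Vmod_def)
  with Kinv KE KF comm show ?thesis
    unfolding is_uq_module_def dim by blast
qed

lemma kron_carrier [simp]:
  "A \<in> carrier_mat a b \<Longrightarrow> B \<in> carrier_mat c d \<Longrightarrow> kron A B \<in> carrier_mat (a * c) (b * d)"
  by (auto simp: kron_def)

lemma sum_mult_range:
  fixes f :: "nat \<Rightarrow> nat \<Rightarrow> scalar"
  shows "(\<Sum>l < b * d. f (l div d) (l mod d)) = (\<Sum>u<b. \<Sum>v<d. f u v)"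
proof (induction b)
  case (Suc b)
  have "(\<Sum>l < Suc b * d. f (l div d) (l mod d)) =
     (\<Sum>l < b * d. f (l div d) (l mod d)) + (\<Sum>l = b * d..<b * d + d. f (l div d) (l mod d))"
    by (simp add: add.commute lessThan_atLeast0 sum.atLeastLessThan_concat)
  also have "(\<Sum>l = b * d..<b * d + d. f (l div d) (l mod d)) = (\<Sum>v<d. f b v)"
  proof -
    have "(\<Sum>l = b * d..<b * d + d. f (l div d) (l mod d))
        = (\<Sum>v<d. f ((b * d + v) div d) ((b * d + v) mod d))"
      by (rule sum.reindex_bij_witness[of _ "\<lambda>v. b * d + v" "\<lambda>l. l - b * d"]) auto
    also have "\<dots> = (\<Sum>v<d. f b v)"
      by (intro sum.cong) auto
    finally show ?thesis .
  qed
  finally show ?case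
    using Suc by simp
qed simp

lemma kron_mult:
  assumes "A \<in> carrier_mat a b" "C \<in> carrier_mat b c" "B \<in> carrier_mat d e" "D \<in> carrier_mat e f"
  shows "kron A B * kron C D = kron (A * C) (B * D)"
proof (rule eq_matI)
  fix i j assume "i < dim_row (kron (A * C) (B * D))" "j < dim_col (kron (A * C) (B * D))"
  then have ij: "i < a * d" "j < c * f"
    using assms by (auto simp: kron_def)
  then have pos: "d > 0" "f > 0"
    by (auto intro: gr0I)
  have bd: "i div d < a" "j div f < c" "i mod d < d" "j mod f < f"
    using ij pos by (auto simp: less_mult_imp_div_less)
  have "(kron A B * kron C D) $$ (i, j) =
     (\<Sum>l < b * e. (A $$ (i div d, l div e) * B $$ (i mod d, l mod e)) *
        (C $$ (l div e, j div f) * D $$ (l mod e, j mod f)))"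
    using assms ij by (auto simp: kron_def scalar_prod_def lessThan_atLeast0 intro!: sum.cong)
  also have "\<dots> = (\<Sum>u<b. \<Sum>v<e. (A $$ (i div d, u) * B $$ (i mod d, v)) *
        (C $$ (u, j div f) * D $$ (v, j mod f)))"
    by (rule sum_mult_range)
  also have "\<dots> = (\<Sum>u<b. A $$ (i div d, u) * C $$ (u, j div f)) *
       (\<Sum>v<e. B $$ (i mod d, v) * D $$ (v, j mod f))"
    by (simp add: sum_product algebra_simps)
  also have "\<dots> = kron (A * C) (B * D) $$ (i, j)"
    using assms ij bd by (auto simp: kron_def scalar_prod_def lessThan_atLeast0)
  finally show "(kron A B * kron C D) $$ (i, j) = kron (A * C) (B * D) $$ (i, j)" .
qed (use assms in \<open>auto simp: kron_def\<close>)

lemma kron_add: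
  assumes "A \<in> carrier_mat a b" "A' \<in> carrier_mat a b" "B \<in> carrier_mat c d" "B' \<in> carrier_mat c d"
  shows "kron (A + A') B = kron A B + kron A' B" "kron (A - A') B = kron A B - kron A' B"
    "kron A (B + B') = kron A B + kron A B'" "kron A (B - B') = kron A B - kron A B'"
    "kron (x \<cdot>\<^sub>m A) B = x \<cdot>\<^sub>m kron A B" "kron A (x \<cdot>\<^sub>m B) = x \<cdot>\<^sub>m kron A B"
proof -
  have *: "i div c < a" if "i < a * c" for i a c :: nat
    using that by (simp add: less_mult_imp_div_less)
  show "kron (A + A') B = kron A B + kron A' B" "kron (A - A') B = kron A B - kron A' B"
    "kron A (B + B') = kron A B + kron A B'" "kron A (B - B') = kron A B - kron A B'"
    "kron (x \<cdot>\<^sub>m A) B = x \<cdot>\<^sub>m kron A B" "kron A (x \<cdot>\<^sub>m B) = x \<cdot>\<^sub>m kron A B"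
    using assms
    by (cases "c = 0"; cases "d = 0"; auto intro!: eq_matI simp: kron_def * algebra_simps)+
qed

lemma kron_bilinear:
  assumes "A \<in> carrier_mat a b" "B \<in> carrier_mat c d"
  shows "A' \<in> carrier_mat a b \<Longrightarrow> kron (A + A') B = kron A B + kron A' B"
    "A' \<in> carrier_mat a b \<Longrightarrow> kron (A - A') B = kron A B - kron A' B"
    "B' \<in> carrier_mat c d \<Longrightarrow> kron A (B + B') = kron A B + kron A B'"
    "B' \<in> carrier_mat c d \<Longrightarrow> kron A (B - B') = kron A B - kron A B'"
    "kron (x \<cdot>\<^sub>m A) B = x \<cdot>\<^sub>m kron A B"
    "kron A (x \<cdot>\<^sub>m B) = x \<cdot>\<^sub>m kron A B"
proof -
  note * = kron_add[OF assms(1,1) assms(2,2)]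
  show "kron (x \<cdot>\<^sub>m A) B = x \<cdot>\<^sub>m kron A B"
    by (rule *(5))
  show "kron A (x \<cdot>\<^sub>m B) = x \<cdot>\<^sub>m kron A B"
    by (rule *(6))
next
  assume "A' \<in> carrier_mat a b"
  note * = kron_add[OF assms(1) this assms(2,2)]
  show "kron (A + A') B = kron A B + kron A' B"
    by (rule *(1))
  show "kron (A - A') B = kron A B - kron A' B"
    by (rule *(2))
next
  assume "B' \<in> carrier_mat c d"
  note * = kron_add[OF assms(1,1) assms(2) this]
  show "kron A (B + B') = kron A B + kron A B'"
    by (rule *(3))
  show "kron A (B - B') = kron A B - kron A B'"
    by (rule *(4))
qed

lemma kron_one: "kron (1\<^sub>m a) (1\<^sub>m b) = 1\<^sub>m (a * b)"
proof (rule eq_matI)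
  fix i j assume "i < dim_row (1\<^sub>m (a * b))" "j < dim_col (1\<^sub>m (a * b))"
  then have ij: "i < a * b" "j < a * b" by auto
  then have "b > 0" by (auto intro: gr0I)
  moreover have "i = j" if "i div b = j div b" "i mod b = j mod b"
    using that by (metis div_mult_mod_eq)
  ultimately show "kron (1\<^sub>m a) (1\<^sub>m b) $$ (i, j) = 1\<^sub>m (a * b) $$ (i, j)"
    using ij by (auto simp: kron_def less_mult_imp_div_less)
qed (auto simp: kron_def)

lemma smult_smult_mat: "x \<cdot>\<^sub>m (y \<cdot>\<^sub>m A) = (x * y) \<cdot>\<^sub>m (A :: scalar mat)"
  by (rule eq_matI) (simp_all add: mult.assoc)

lemma one_smult_mat: "1 \<cdot>\<^sub>m A = (A :: scalar mat)"
  by (rule eq_matI) simp_all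

lemma add4:
  assumes "P \<in> carrier_mat a b" "Y \<in> carrier_mat a b" "Z \<in> carrier_mat a b" "S \<in> carrier_mat a b"
    "P' \<in> carrier_mat a b" "S' \<in> carrier_mat a b"
  shows "((P + Y) + (Z + S)) - ((P' + Z) + (Y + S')) = (P - P') + (S - (S' :: scalar mat))"
  using assms by (intro eq_matI) auto

lemma add3:
  assumes "P \<in> carrier_mat a b" "Y \<in> carrier_mat a b" "Z \<in> carrier_mat a b"
  shows "d \<cdot>\<^sub>m (P - Y) + d \<cdot>\<^sub>m (Y - Z) = d \<cdot>\<^sub>m (P - (Z :: scalar mat))"
  using assms by (intro eq_matI) (auto simp: algebra_simps)

lemma tensor_module_is_uq_module:
  assumes M: "is_uq_module k M" and N: "is_uq_module k N"
  shows "is_uq_module k (tensor_module M N)"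
proof -
  define a b z d where "a = rdim M" and "b = rdim N" and "z = qq k ^ 2"
    and "d = inverse (qq k - inverse (qq k))"
  have z: "z \<noteq> 0"
    by (simp add: z_def)
  define E F K L where "E = opE M" and "F = opF M" and "K = opK M" and "L = opKinv M"
  define E' F' K' L' where "E' = opE N" and "F' = opF N" and "K' = opK N" and "L' = opKinv N"
  note defs = a_def b_def z_def d_def E_def F_def K_def L_def E'_def F'_def K'_def L'_def
  have C [simp]: "E \<in> carrier_mat a a" "F \<in> carrier_mat a a" "K \<in> carrier_mat a a"
    "L \<in> carrier_mat a a" "E' \<in> carrier_mat b b" "F' \<in> carrier_mat b b" "K' \<in> carrier_mat b b"
    "L' \<in> carrier_mat b b"
    using M N by (auto simp: is_uq_module_def defs)
  have KL: "K * L = 1\<^sub>m a" "L * K = 1\<^sub>m a" "K' * L' = 1\<^sub>m b" "L' * K' = 1\<^sub>m b"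
    and conj: "K * E * L = z \<cdot>\<^sub>m E" "K' * E' * L' = z \<cdot>\<^sub>m E'"
      "K * F * L = inverse z \<cdot>\<^sub>m F" "K' * F' * L' = inverse z \<cdot>\<^sub>m F'"
    and comm: "E * F - F * E = d \<cdot>\<^sub>m (K - L)" "E' * F' - F' * E' = d \<cdot>\<^sub>m (K' - L')"
    using M N by (auto simp: is_uq_module_def defs)
  have mm [simp]: "X * Y \<in> carrier_mat c c" if "X \<in> carrier_mat c c" "Y \<in> carrier_mat c c"
    for X Y :: "scalar mat" and c
    using that by simp
  have kc [simp]: "kron X Y \<in> carrier_mat (a * b) (a * b)"
    if "X \<in> carrier_mat a a" "Y \<in> carrier_mat b b" for X Y
    using that by simp
  have km: "kron X Y * kron X' Y' = kron (X * X') (Y * Y')"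
    if "X \<in> carrier_mat a a" "X' \<in> carrier_mat a a" "Y \<in> carrier_mat b b" "Y' \<in> carrier_mat b b"
    for X X' Y Y'
    by (rule kron_mult[OF that])
  note one = left_mult_one_mat[of _ a a] right_mult_one_mat[of _ a a]
    left_mult_one_mat[of _ b b] right_mult_one_mat[of _ b b]
  note KB = kron_bilinear[of _ a a _ b b]
  have EL: "E * L = z \<cdot>\<^sub>m (L * E)"
  proof -
    have "E * L = (L * K) * (E * L)"
      unfolding KL using left_mult_one_mat[of "E * L" a a] by simp
    also have "\<dots> = L * (K * E * L)"
      by (simp add: assoc_mult_mat[of _ a a _ a _ a])
    also have "\<dots> = z \<cdot>\<^sub>m (L * E)"
      unfolding conj by (rule mult_smult_distrib[of _ a a _ a]) simp_all
    finally show ?thesis .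
  qed
  have KF: "K' * F' = inverse z \<cdot>\<^sub>m (F' * K')"
  proof -
    have "K' * F' = K' * F' * (L' * K')"
      unfolding KL using right_mult_one_mat[of "K' * F'" b b] by simp
    also have "\<dots> = (K' * F' * L') * K'"
      by (simp add: assoc_mult_mat[of _ b b _ b _ b])
    also have "\<dots> = inverse z \<cdot>\<^sub>m (F' * K')"
      unfolding conj by (rule mult_smult_assoc_mat[of _ b b _ b]) simp_all
    finally show ?thesis .
  qed
  have cross: "kron (E * L) (K' * F') = kron (L * E) (F' * K')"
    unfolding EL KF using z
    by (simp add: KB(5) KB(6) smult_smult_mat one_smult_mat)
  define DE DF where "DE = kron E K' + kron (1\<^sub>m a) E'" and "DF = kron F (1\<^sub>m b) + kron L F'"
  have DC: "DE \<in> carrier_mat (a * b) (a * b)" "DF \<in> carrier_mat (a * b) (a * b)"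
    by (auto simp: DE_def DF_def)
  have EF: "DE * DF = (kron (E * F) K' + kron F E') + (kron (E * L) (K' * F') + kron L (E' * F'))"
    unfolding DE_def DF_def
    by (simp add: add_mult_distrib_mat[of _ "a * b" "a * b" _ _ "a * b"]
        mult_add_distrib_mat[of _ "a * b" "a * b" _ "a * b"] km one)
  have FE: "DF * DE = (kron (F * E) K' + kron (L * E) (F' * K')) + (kron F E' + kron L (F' * E'))"
    unfolding DE_def DF_def
    by (simp add: add_mult_distrib_mat[of _ "a * b" "a * b" _ _ "a * b"]
        mult_add_distrib_mat[of _ "a * b" "a * b" _ "a * b"] km one)
  have "DE * DF - DF * DE = kron (E * F - F * E) K' + kron L (E' * F' - F' * E')"
    unfolding EF FE cross
    by (simp add: KB(2) KB(4)) (rule add4[of _ "a * b" "a * b"]; simp)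
  also have "\<dots> = d \<cdot>\<^sub>m (kron K K' - kron L L')"
    unfolding comm
    by (simp add: KB(2) KB(4) KB(5) KB(6) minus_carrier_mat[of _ a a] minus_carrier_mat[of _ b b])
       (rule add3[of _ "a * b" "a * b"]; simp)
  finally have 1: "DE * DF - DF * DE = d \<cdot>\<^sub>m (kron K K' - kron L L')" .
  have KKL: "K * K * L = K" "K' * K' * L' = K'"
    by (simp_all add: KL one assoc_mult_mat[of _ a a _ a _ a] assoc_mult_mat[of _ b b _ b _ b])
  have 2: "kron K K' * DE * kron L L' = z \<cdot>\<^sub>m DE"
    unfolding DE_def
    by (simp add: add_mult_distrib_mat[of _ "a * b" "a * b" _ _ "a * b"]
        mult_add_distrib_mat[of _ "a * b" "a * b" _ "a * b"] km one KL KKL conj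
        KB(5) KB(6)
        add_smult_distrib_left_mat[of _ "a * b" "a * b"])
  have 3: "kron K K' * DF * kron L L' = inverse z \<cdot>\<^sub>m DF"
  proof -
    have "K * L * L = L" by (simp add: KL one)
    then show ?thesis
      unfolding DF_def
      by (simp add: add_mult_distrib_mat[of _ "a * b" "a * b" _ _ "a * b"]
        mult_add_distrib_mat[of _ "a * b" "a * b" _ "a * b"] km one KL KKL conj
        KB(5) KB(6)
        add_smult_distrib_left_mat[of _ "a * b" "a * b"])
  qed
  have 4: "kron K K' * kron L L' = 1\<^sub>m (a * b)" "kron L L' * kron K K' = 1\<^sub>m (a * b)"
    by (simp_all add: km KL kron_one)
  have 5: "kron K K' \<in> carrier_mat (a * b) (a * b)" "kron L L' \<in> carrier_mat (a * b) (a * b)"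
    by simp_all
  show ?thesis
    unfolding is_uq_module_def tensor_module_def uq_module.simps defs[symmetric]
    using 1 2 3 4 5 DC unfolding DE_def DF_def by blast
qed

lemma shift_pow_zero:
  assumes A: "A \<in> carrier_mat m m"
    and shift: "\<And>i j. i < m \<Longrightarrow> j < m \<Longrightarrow> int j \<noteq> int i + s \<Longrightarrow> A $$ (i, j) = (0 :: scalar)"
  shows "i < m \<Longrightarrow> j < m \<Longrightarrow> int j \<noteq> int i + int a * s \<Longrightarrow> (A ^\<^sub>m a) $$ (i, j) = 0"
proof (induction a arbitrary: j)
  case (Suc a)
  have "(A ^\<^sub>m Suc a) $$ (i, j) = (\<Sum>l = 0..<m. (A ^\<^sub>m a) $$ (i, l) * A $$ (l, j))"
    using A Suc.prems pow_carrier_mat[OF A, of a] by (auto simp: scalar_prod_def)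
  also have "\<dots> = 0"
  proof (intro sum.neutral ballI)
    fix l assume l: "l \<in> {0..<m}"
    show "(A ^\<^sub>m a) $$ (i, l) * A $$ (l, j) = 0"
    proof (cases "int l = int i + int a * s")
      case True
      then have "int j \<noteq> int l + s"
        using Suc.prems(3) by (auto simp: algebra_simps)
      then show ?thesis
        using shift[of l j] l Suc.prems(2) by simp
    next
      case False
      then show ?thesis
        using Suc.IH[OF Suc.prems(1), of l] l by simp
    qed
  qed
  finally show ?case .
qed (use A in auto)

lemma divpow_E_eq_0:
  assumes "a > n"
  shows "divpow k (opE (Vmod k n)) a = 0\<^sub>m (n + 1) (n + 1)"
proof -
  have C: "opE (Vmod k n) \<in> carrier_mat (n + 1) (n + 1)"
    by (simp add: Vmod_def)
  have "(opE (Vmod k n) ^\<^sub>m a) $$ (i, j) = 0" if "i < n + 1" "j < n + 1" for i j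
    by (rule shift_pow_zero[OF C, where s = 1]) (use assms that in \<open>auto simp: Vmod_def\<close>)
  then show ?thesis
    using carrier_matD[OF pow_carrier_mat[OF C, of a]] by (intro eq_matI) (simp_all add: divpow_def)
qed

lemma divpow_F_eq_0:
  assumes "b > n"
  shows "divpow k (opF (Vmod k n)) b = 0\<^sub>m (n + 1) (n + 1)"
proof -
  have C: "opF (Vmod k n) \<in> carrier_mat (n + 1) (n + 1)"
    by (simp add: Vmod_def)
  have "(opF (Vmod k n) ^\<^sub>m b) $$ (i, j) = 0" if "i < n + 1" "j < n + 1" for i j
    by (rule shift_pow_zero[OF C, where s = "- 1"]) (use assms that in \<open>auto simp: Vmod_def\<close>)
  then show ?thesis
    using carrier_matD[OF pow_carrier_mat[OF C, of b]] by (intro eq_matI) (simp_all add: divpow_def)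
qed

end

theory Submission
  imports Defs
begin

text \<open>
  Only the trivial and the two-dimensional module matter. Put \<open>S = t\<^sup>-\<^sup>1\<close> and \<open>Y = X\<^sup>-\<^sup>1\<close> on \<open>V\<^sub>1\<close>. The
  coproduct equation on \<open>V\<^sub>0 \<otimes> V\<^sub>0\<close> gives \<open>t = 1\<close> on \<open>V\<^sub>0\<close>. Let \<open>u = q v\<^sub>0 \<otimes> v\<^sub>1 - v\<^sub>1 \<otimes> v\<^sub>0\<close> span
  the copy of \<open>V\<^sub>0\<close> in \<open>V\<^sub>1 \<otimes> V\<^sub>1\<close>. Both \<open>\<Delta>t\<close> and \<open>\<Delta>X\<close> fix \<open>u\<close>, so \<open>(S \<otimes> S) u = (Y \<otimes> Y) u\<close>.
  As \<open>u\<close> is not symmetric, this forces \<open>S\<close> to be antidiagonal like \<open>Y\<close>, with the same product of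
  antidiagonal entries. Hence \<open>S\<^sup>2 = Y\<^sup>2\<close>, but \<open>Y\<^sup>2 = - C\<close> on \<open>V\<^sub>1\<close>.
\<close>

section \<open>Homomorphisms between irreducible modules\<close>

text \<open>The parameter \<open>q\<close> has infinite order, so an eigenvalue of \<open>K\<close>
  determines the weight. This is what tells the modules \<open>Vmod k n\<close> apart.\<close>

lemma qq_powi_inject:
  assumes "k > 0" and "qq k powi a = qq k powi b"
  shows "a = b"
proof -
  have *: "a \<le> b" if "qq k powi a = qq k powi b" for a b
  proof (rule ccontr)
    assume "\<not> a \<le> b"
    then obtain d where d: "d > 0" "a - b = int d"
      using zero_less_imp_eq_int[of "a - b"] by auto
    have "qq k powi (a - b) = 1"
      using that by (simp add: power_int_diff)
    then have "qroot ^ (k * d) = 1"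
      unfolding d(2) by (simp add: power_mult)
    then show False
      using qroot_power_neq_1[of "k * d"] d(1) assms(1) by simp
  qed
  show ?thesis
    using *[of a b] *[of b a] assms(2) by simp
qed

section \<open>Matrix entries of products with \<open>E\<close> and \<open>F\<close>\<close>

lemma Vmod_carrier [simp]:
  "rdim (Vmod k n) = n + 1"
  "opE (Vmod k n) \<in> carrier_mat (n + 1) (n + 1)"
  "opF (Vmod k n) \<in> carrier_mat (n + 1) (n + 1)"
  "opK (Vmod k n) \<in> carrier_mat (n + 1) (n + 1)"
  "opKinv (Vmod k n) \<in> carrier_mat (n + 1) (n + 1)"
  by (simp_all add: Vmod_def)

lemma mult_opE_col_0:
  assumes "h \<in> carrier_mat r (n + 1)" and "i < r"
  shows "(h * opE (Vmod k n)) $$ (i, 0) = 0"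
  using assms by (auto simp: Vmod_def scalar_prod_def intro!: sum.neutral)

lemma opE_mult:
  assumes "h \<in> carrier_mat (m + 1) s" and "i < m" and "j < s"
  shows "(opE (Vmod k m) * h) $$ (i, j) = qint k (int m - int i) * h $$ (i + 1, j)"
  using assms by (simp add: Vmod_def scalar_prod_def if_distrib[of "\<lambda>x. x * _"] sum.delta
      cong: if_cong del: sum.op_ivl_Suc)

lemma mult_opF:
  assumes "h \<in> carrier_mat r (n + 1)" and "i < r" and "j < n"
  shows "(h * opF (Vmod k n)) $$ (i, j) = h $$ (i, j + 1) * qint k (int (j + 1))"
  using assms by (simp add: Vmod_def scalar_prod_def if_distrib[of "\<lambda>x. _ * x"] sum.delta add.commute
      cong: if_cong del: sum.op_ivl_Suc)

lemma opF_mult: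
  assumes "h \<in> carrier_mat (m + 1) s" and "i < m + 1" and "j < s"
  shows "(opF (Vmod k m) * h) $$ (i, j) = (if i = 0 then 0 else qint k (int i) * h $$ (i - 1, j))"
  using assms by (cases i) (simp_all add: Vmod_def scalar_prod_def if_distrib[of "\<lambda>x. x * _"]
      sum.delta sum.delta' add.commute cong: if_cong del: sum.op_ivl_Suc)

text \<open>The image of v_0 is killed by \<open>E\<close>, whose kernel is the line of v_0 because
  its coefficients are nonzero quantum integers. This settles column 0; commutation with
  \<open>F\<close> carries the result from each column to the next.\<close>

lemma schur_entry:
  assumes k: "k > 0" and h: "intertwiner (Vmod k n) (Vmod k m) h"
  shows "j \<le> n \<Longrightarrow> i \<le> m \<Longrightarrow> h $$ (i, j) = (if i = j then h $$ (0, 0) else 0)"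
proof (induction j arbitrary: i)
  have C: "h \<in> carrier_mat (m + 1) (n + 1)"
    and E: "h * opE (Vmod k n) = opE (Vmod k m) * h"
    and F: "h * opF (Vmod k n) = opF (Vmod k m) * h"
    using h by (auto simp: intertwiner_def)
  {
    case 0
    show ?case
    proof (cases i)
      case (Suc l)
      have "qint k (int m - int l) * h $$ (l + 1, 0) = 0"
        using mult_opE_col_0[OF C, of l k] opE_mult[OF C, of l 0 k] E 0 Suc by simp
      moreover have "qint k (int m - int l) \<noteq> 0"
        using qint_nonzero[OF k, of "m - l"] 0 Suc by (simp add: of_nat_diff)
      ultimately show ?thesis
        using Suc by simp
    qed simp
  next
    case (Suc j)
    have "h $$ (i, j + 1) * qint k (int (j + 1))
        = (if i = 0 then 0 else qint k (int i) * h $$ (i - 1, j))"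
      using mult_opF[OF C, of i j k] opF_mult[OF C, of i j k] F Suc.prems by simp
    also have "\<dots> = (if i = j + 1 then h $$ (0, 0) else 0) * qint k (int (j + 1))"
      using Suc.IH[of "i - 1"] Suc.prems by (cases i) auto
    finally show ?case
      using qint_nonzero[OF k, of "j + 1"] by simp
  }
qed

text \<open>The eigenvalues of \<open>K\<close> on the two highest weight vectors differ. Together
  with \<open>schur_entry\<close> this makes the whole homomorphism vanish.\<close>

lemma schur_neq:
  assumes k: "k > 0" and h: "intertwiner (Vmod k n) (Vmod k m) h" and "n \<noteq> m"
  shows "h $$ (0, 0) = 0"
proof -
  have C: "h \<in> carrier_mat (m + 1) (n + 1)"
    and K: "h * opK (Vmod k n) = opK (Vmod k m) * h"
    using h by (auto simp: intertwiner_def)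
  have "(h * opK (Vmod k n)) $$ (0, 0) = h $$ (0, 0) * qq k powi int n"
    using C by (simp add: Vmod_def scalar_prod_def sum.delta if_distrib[of "\<lambda>x. _ * x"]
        cong: if_cong del: sum.op_ivl_Suc)
  moreover have "(opK (Vmod k m) * h) $$ (0, 0) = qq k powi int m * h $$ (0, 0)"
    using C by (simp add: Vmod_def scalar_prod_def sum.delta if_distrib[of "\<lambda>x. x * _"]
        cong: if_cong del: sum.op_ivl_Suc)
  ultimately have "h $$ (0, 0) = 0 \<or> qq k powi int n = qq k powi int m"
    using K by auto
  then show ?thesis
    using qq_powi_inject[OF k, of "int n" "int m"] assms(3) by (metis of_nat_eq_iff)
qed

text \<open>By Schur's lemma \<open>h\<close> is zero or a scalar matrix, so any family of matrices
  commutes with it. The existence of the operator described by \<open>act\<close> rests on this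
  naturality.\<close>

lemma intertwiner_natural:
  assumes k: "k > 0" and h: "intertwiner (Vmod k n) (Vmod k m) h"
    and x: "\<And>n. x n \<in> carrier_mat (n + 1) (n + 1)"
  shows "x m * h = h * x n"
proof (cases "n = m")
  case True
  have "h = h $$ (0, 0) \<cdot>\<^sub>m 1\<^sub>m (n + 1)"
  proof (rule eq_matI)
    fix i j assume "i < dim_row (h $$ (0, 0) \<cdot>\<^sub>m 1\<^sub>m (n + 1))"
      and "j < dim_col (h $$ (0, 0) \<cdot>\<^sub>m 1\<^sub>m (n + 1))"
    then show "h $$ (i, j) = (h $$ (0, 0) \<cdot>\<^sub>m 1\<^sub>m (n + 1)) $$ (i, j)"
      using schur_entry[OF k h, of j i] True by simp
  qed (use h True in \<open>auto simp: intertwiner_def\<close>)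
  then obtain c where c: "h = c \<cdot>\<^sub>m 1\<^sub>m (n + 1)" ..
  have "x n * (c \<cdot>\<^sub>m 1\<^sub>m (n + 1)) = c \<cdot>\<^sub>m (x n * 1\<^sub>m (n + 1))"
    by (rule mult_smult_distrib[OF x one_carrier_mat])
  moreover have "(c \<cdot>\<^sub>m 1\<^sub>m (n + 1)) * x n = c \<cdot>\<^sub>m (1\<^sub>m (n + 1) * x n)"
    by (rule mult_smult_assoc_mat[OF one_carrier_mat x])
  ultimately show ?thesis
    using x[of n] by (simp add: c flip: True)
next
  case False
  have "h = 0\<^sub>m (m + 1) (n + 1)"
  proof (rule eq_matI)
    fix i j assume "i < dim_row (0\<^sub>m (m + 1) (n + 1) :: scalar mat)"
      "j < dim_col (0\<^sub>m (m + 1) (n + 1) :: scalar mat)"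
    then show "h $$ (i, j) = 0\<^sub>m (m + 1) (n + 1) $$ (i, j)"
      using schur_entry[OF k h, of j i] schur_neq[OF k h False] by simp
  qed (use h in \<open>auto simp: intertwiner_def\<close>)
  then show ?thesis
    using x[of n] x[of m] by simp
qed

section \<open>The action of the completion\<close>

lemma intertwiner_comp:
  assumes "is_uq_module k M" "is_uq_module k N" "is_uq_module k L"
    and f: "intertwiner M N f" and g: "intertwiner N L g"
  shows "intertwiner M L (g * f)"
proof -
  have fC: "f \<in> carrier_mat (rdim N) (rdim M)" and gC: "g \<in> carrier_mat (rdim L) (rdim N)"
    using f g by (auto simp: intertwiner_def)
  have *: "g * f * A = C * (g * f)"
    if "f * A = B * f" "g * B = C * g" "A \<in> carrier_mat (rdim M) (rdim M)"
      "B \<in> carrier_mat (rdim N) (rdim N)" "C \<in> carrier_mat (rdim L) (rdim L)" for A B C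
  proof -
    have "g * f * A = g * (B * f)"
      unfolding that(1)[symmetric] by (rule assoc_mult_mat[OF gC fC that(3)])
    also have "\<dots> = C * g * f"
      unfolding that(2)[symmetric] by (rule assoc_mult_mat[OF gC that(4) fC, symmetric])
    also have "\<dots> = C * (g * f)"
      by (rule assoc_mult_mat[OF that(5) gC fC])
    finally show ?thesis .
  qed
  show ?thesis
    unfolding intertwiner_def
  proof (intro conjI)
    show "g * f \<in> carrier_mat (rdim L) (rdim M)"
      by (rule mult_carrier_mat[OF gC fC])
    show "g * f * opE M = opE L * (g * f)"
      by (rule *[of _ "opE N"]) (use assms in \<open>auto simp: intertwiner_def is_uq_module_def\<close>)
    show "g * f * opF M = opF L * (g * f)"
      by (rule *[of _ "opF N"]) (use assms in \<open>auto simp: intertwiner_def is_uq_module_def\<close>)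
    show "g * f * opK M = opK L * (g * f)"
      by (rule *[of _ "opK N"]) (use assms in \<open>auto simp: intertwiner_def is_uq_module_def\<close>)
    show "g * f * opKinv M = opKinv L * (g * f)"
      by (rule *[of _ "opKinv N"]) (use assms in \<open>auto simp: intertwiner_def is_uq_module_def\<close>)
  qed
qed

text \<open>The definite description in \<open>act\<close> denotes something useful only once
  existence and uniqueness are known. A resolution of the identity of \<open>M\<close> through V_a
  and V_b supplies both.\<close>

lemma act_intertwiner:
  assumes k: "k > 0" and M: "is_uq_module k M"
    and x: "\<And>n. x n \<in> carrier_mat (n + 1) (n + 1)"
    and f: "intertwiner (Vmod k a) M f" "intertwiner (Vmod k b) M f'"
    and g: "intertwiner M (Vmod k a) g" "intertwiner M (Vmod k b) g'"
    and split: "f * g + f' * g' = 1\<^sub>m (rdim M)"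
  shows "act k x M \<in> carrier_mat (rdim M) (rdim M)"
    and "intertwiner (Vmod k n) M u \<Longrightarrow> act k x M * u = u * x n"
proof -
  define d where "d = rdim M"
  define P where "P A \<longleftrightarrow> A \<in> carrier_mat d d \<and>
     (\<forall>n f. intertwiner (Vmod k n) M f \<longrightarrow> A * f = f * x n)" for A
  have C: "f \<in> carrier_mat d (a + 1)" "f' \<in> carrier_mat d (b + 1)"
    "g \<in> carrier_mat (a + 1) d" "g' \<in> carrier_mat (b + 1) d"
    using f g by (auto simp: intertwiner_def d_def)
  define A where "A = f * x a * g + f' * x b * g'"
  have "P A"
    unfolding P_def
  proof (intro conjI allI impI)
    show "A \<in> carrier_mat d d"
      using C x[of a] x[of b] by (auto simp: A_def)
    fix n v assume v: "intertwiner (Vmod k n) M v"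
    then have vC: "v \<in> carrier_mat d (n + 1)"
      by (simp add: intertwiner_def d_def)
    have *: "p * x c * p' * v = p * p' * v * x n"
      if "intertwiner M (Vmod k c) p'" "p \<in> carrier_mat d (c + 1)" for c p p'
    proof -
      have p'C: "p' \<in> carrier_mat (c + 1) d"
        using that by (simp add: intertwiner_def d_def)
      \<comment> \<open>The composite V_n \<rightarrow> \<open>M\<close> \<rightarrow> V_c is a
        homomorphism of irreducibles, so naturality applies to it.\<close>
      have "x c * (p' * v) = (p' * v) * x n"
        by (intro intertwiner_natural[OF k _ x] intertwiner_comp[OF _ M _ v that(1)]
            Vmod_is_uq_module k)
      then have "p * (x c * (p' * v)) = p * ((p' * v) * x n)"
        by simp
      moreover have "p * x c * p' * v = p * x c * (p' * v)"
        by (rule assoc_mult_mat[OF mult_carrier_mat[OF that(2) x] p'C vC])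
      moreover have "p * x c * (p' * v) = p * (x c * (p' * v))"
        by (rule assoc_mult_mat[OF that(2) x mult_carrier_mat[OF p'C vC]])
      moreover have "p * p' * v * x n = p * (p' * v) * x n"
        by (subst assoc_mult_mat[OF that(2) p'C vC]) simp
      moreover have "p * (p' * v) * x n = p * ((p' * v) * x n)"
        by (rule assoc_mult_mat[OF that(2) mult_carrier_mat[OF p'C vC] x])
      ultimately show ?thesis
        by simp
    qed
    have "A * v = f * x a * g * v + f' * x b * g' * v"
      unfolding A_def using C vC x[of a] x[of b]
      by (intro add_mult_distrib_mat[of _ d d _ _ "n + 1"]) auto
    also have "\<dots> = f * g * v * x n + f' * g' * v * x n"
      using *[OF g(1) C(1)] *[OF g(2) C(2)] by simp
    also have "\<dots> = (f * g + f' * g') * v * x n"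
    proof -
      have gC: "f * g \<in> carrier_mat d d" "f' * g' \<in> carrier_mat d d"
        using C by auto
      show ?thesis
        unfolding add_mult_distrib_mat[OF gC vC]
        by (rule add_mult_distrib_mat[symmetric, OF _ _ x]) (use gC vC in auto)
    qed
    also have "\<dots> = v * x n"
      using split vC by (simp add: d_def)
    finally show "A * v = v * x n" .
  qed
  moreover have "B = A" if "P B" for B
  proof -
    have B: "B \<in> carrier_mat d d" "B * f = f * x a" "B * f' = f' * x b"
      using that f by (auto simp: P_def)
    \<comment> \<open>Uniqueness: the images of \<open>f\<close> and \<open>f'\<close> span
      \<open>M\<close>, and on them \<open>B\<close> is prescribed.\<close>
    have "B = B * (f * g + f' * g')"
      using split B by (simp add: d_def)
    also have "\<dots> = B * (f * g) + B * (f' * g')"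
      using B(1) C by (intro mult_add_distrib_mat[of _ d d _ d]) auto
    also have "\<dots> = B * f * g + B * f' * g'"
      unfolding assoc_mult_mat[OF B(1) C(1,3)] assoc_mult_mat[OF B(1) C(2,4)] ..
    finally show ?thesis
      using B by (simp add: A_def)
  qed
  ultimately have "P (THE A. P A)"
    by (rule theI)
  moreover have "act k x M = (THE A. P A)"
    unfolding act_def P_def d_def ..
  ultimately show "act k x M \<in> carrier_mat (rdim M) (rdim M)"
    and "intertwiner (Vmod k n) M u \<Longrightarrow> act k x M * u = u * x n"
    by (auto simp: P_def d_def)
qed

lemma intertwiner_id:
  assumes "is_uq_module k M"
  shows "intertwiner M M (1\<^sub>m (rdim M))"
  using assms by (auto simp: intertwiner_def is_uq_module_def)

lemma intertwiner_0:
  assumes "is_uq_module k M" "is_uq_module k N"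
  shows "intertwiner M N (0\<^sub>m (rdim N) (rdim M))"
  using assms by (auto simp: intertwiner_def is_uq_module_def)

text \<open>Take the decomposition of V_n whose first summand is V_n itself, through identity maps,
  and whose second summand contributes through zero maps.\<close>

lemma act_Vmod:
  assumes k: "k > 0" and x: "\<And>n. x n \<in> carrier_mat (n + 1) (n + 1)"
  shows "act k x (Vmod k n) = x n"
proof -
  have M: "is_uq_module k (Vmod k n)"
    by (rule Vmod_is_uq_module[OF k])
  note id = intertwiner_id[OF M] and zero = intertwiner_0[OF M M]
  have split: "1\<^sub>m (rdim (Vmod k n)) * 1\<^sub>m (rdim (Vmod k n))
      + 0\<^sub>m (rdim (Vmod k n)) (rdim (Vmod k n)) * 0\<^sub>m (rdim (Vmod k n)) (rdim (Vmod k n))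
      = (1\<^sub>m (rdim (Vmod k n)) :: scalar mat)"
    by simp
  have "act k x (Vmod k n) * 1\<^sub>m (n + 1) = 1\<^sub>m (n + 1) * x n"
    using act_intertwiner(2)[OF k M x id zero id zero split id] by simp
  then show ?thesis
    using right_mult_one_mat[OF act_intertwiner(1)[OF k M x id zero id zero split]]
      left_mult_one_mat[OF x[of n]] by simp
qed

text \<open>Every Kronecker product involved is of 1 by 1 matrices, so the two records are literally
  equal and \<open>coprod\<close> on V_0 \<otimes> V_0 needs no isomorphism.\<close>

lemma tensor_Vmod_0: "tensor_module (Vmod k 0) (Vmod k 0) = Vmod k 0"
  by (auto simp: tensor_module_def Vmod_def kron_def intro!: eq_matI)

section \<open>The tensor square of the two-dimensional module\<close>

lemma mat_eq_mat_of_rows_list: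
  "mat nr nc f = mat_of_rows_list nc (map (\<lambda>i. map (\<lambda>j. f (i, j)) [0..<nc]) [0..<nr])"
  by (rule eq_matI) (auto simp: mat_of_rows_list_def)

lemma mat_2_eq_mat_of_rows_list:
  "A \<in> carrier_mat 2 2 \<Longrightarrow>
    A = mat_of_rows_list 2 [[A $$ (0, 0), A $$ (0, 1)], [A $$ (1, 0), A $$ (1, 1)]]"
  by (intro eq_matI) (auto simp: mat_of_rows_list_def less_Suc_eq numeral_2_eq_2)

lemma mult_mat_of_rows_list:
  assumes "\<forall>r\<in>set A. length r = length B" and "n = length B"
  shows "mat_of_rows_list n A * mat_of_rows_list m B
    = mat_of_rows_list m (map (\<lambda>r. map (\<lambda>j. \<Sum>(a, s)\<leftarrow>zip r B. a * s ! j) [0..<m]) A)"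
    (is "_ = ?C")
proof (rule eq_matI)
  fix i j assume "i < dim_row ?C" and "j < dim_col ?C"
  then have "i < length A" "j < m"
    by (auto simp: mat_of_rows_list_def)
  then show "(mat_of_rows_list n A * mat_of_rows_list m B) $$ (i, j) = ?C $$ (i, j)"
    using assms by (auto simp: mat_of_rows_list_def scalar_prod_def sum_list_sum_nth intro!: sum.cong)
qed (auto simp: mat_of_rows_list_def)

lemma add_mat_of_rows_list:
  assumes "length A = length B" "\<forall>r\<in>set A. length r = m" "\<forall>r\<in>set B. length r = m"
  shows "mat_of_rows_list m A + mat_of_rows_list m B = mat_of_rows_list m (map2 (map2 (+)) A B)"
  using assms by (intro eq_matI) (auto simp: mat_of_rows_list_def)

lemma upto_small:
  "[0..<2] = [0, 1]" "[0..<3] = [0, 1, 2]" "[0..<4] = [0, 1, 2, 3]"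
  by (simp_all add: upt_rec)

lemma kron_2_2:
  "kron (mat_of_rows_list 2 [[a, b], [c, d]]) (mat_of_rows_list 2 [[a', b'], [c', d']])
    = mat_of_rows_list 4
       [[a * a', a * b', b * a', b * b'], [a * c', a * d', b * c', b * d'],
        [c * a', c * b', d * a', d * b'], [c * c', c * d', d * c', d * d']]"
proof -
  have "Suc (Suc (Suc 0)) div Suc (Suc 0) = Suc 0" "Suc (Suc (Suc 0)) mod Suc (Suc 0) = Suc 0"
    by (simp_all flip: numeral_2_eq_2 numeral_3_eq_3)
  then show ?thesis
    by (simp add: kron_def mat_eq_mat_of_rows_list[of _ 4] upto_small mat_of_rows_list_def[of 2])
qed

section \<open>The small modules and V_1 \<otimes> V_1 in coordinates\<close>

lemma qint_1: "k > 0 \<Longrightarrow> qint k 1 = 1"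
  using q_minus_inverse_nonzero by (simp add: qint_def power_int_minus)

lemma qint_2:
  assumes "k > 0"
  shows "qint k 2 = qq k + inverse (qq k)"
proof -
  have "qint k 2 = (qq k ^ 2 - inverse (qq k ^ 2)) / (qq k - inverse (qq k))"
    by (simp add: qint_def power_int_minus)
  also have "qq k ^ 2 - inverse (qq k ^ 2) = (qq k + inverse (qq k)) * (qq k - inverse (qq k))"
    by (simp add: field_simps power2_eq_square)
  finally show ?thesis
    using q_minus_inverse_nonzero[OF assms] by simp
qed

lemma Vmod_0:
  "Vmod k 0 = \<lparr>rdim = 1, opE = mat_of_rows_list 1 [[0]], opF = mat_of_rows_list 1 [[0]],
     opK = mat_of_rows_list 1 [[1]], opKinv = mat_of_rows_list 1 [[1]]\<rparr>"
  by (simp add: Vmod_def mat_eq_mat_of_rows_list[of "Suc 0"])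

lemma Vmod_1:
  assumes "k > 0"
  shows "Vmod k 1 = \<lparr>rdim = 2,
     opE = mat_of_rows_list 2 [[0, 1], [0, 0]],
     opF = mat_of_rows_list 2 [[0, 0], [1, 0]],
     opK = mat_of_rows_list 2 [[qq k, 0], [0, inverse (qq k)]],
     opKinv = mat_of_rows_list 2 [[inverse (qq k), 0], [0, qq k]]\<rparr>"
proof -
  have "(1::nat) + 1 = 2" by simp
  then show ?thesis
    unfolding Vmod_def
    by (simp add: mat_eq_mat_of_rows_list[of "Suc (Suc 0)"] numeral_2_eq_2
        qint_1[OF assms, simplified] power_int_minus)
qed

lemma Vmod_2:
  assumes "k > 0"
  shows "Vmod k 2 = \<lparr>rdim = 3,
     opE = mat_of_rows_list 3 [[0, qint k 2, 0], [0, 0, 1], [0, 0, 0]],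
     opF = mat_of_rows_list 3 [[0, 0, 0], [1, 0, 0], [0, qint k 2, 0]],
     opK = mat_of_rows_list 3 [[qq k * qq k, 0, 0], [0, 1, 0], [0, 0, inverse (qq k * qq k)]],
     opKinv = mat_of_rows_list 3 [[inverse (qq k * qq k), 0, 0], [0, 1, 0], [0, 0, qq k * qq k]]\<rparr>"
proof -
  have "(2::nat) + 1 = 3" by simp
  then show ?thesis
    unfolding Vmod_def
    by (simp add: mat_eq_mat_of_rows_list[of 3] upto_small qint_1[OF assms, simplified]
        power_int_minus power2_eq_square)
qed

lemma tensor_Vmod_1:
  assumes "k > 0"
  shows "tensor_module (Vmod k 1) (Vmod k 1) = \<lparr>rdim = 4,
    opE = mat_of_rows_list 4 [[0, 1, qq k, 0], [0, 0, 0, inverse (qq k)], [0, 0, 0, 1], [0, 0, 0, 0]],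
    opF = mat_of_rows_list 4 [[0, 0, 0, 0], [inverse (qq k), 0, 0, 0], [1, 0, 0, 0], [0, 1, qq k, 0]],
    opK = mat_of_rows_list 4
      [[qq k * qq k, 0, 0, 0], [0, 1, 0, 0], [0, 0, 1, 0], [0, 0, 0, inverse (qq k * qq k)]],
    opKinv = mat_of_rows_list 4
      [[inverse (qq k * qq k), 0, 0, 0], [0, 1, 0, 0], [0, 0, 1, 0], [0, 0, 0, qq k * qq k]]\<rparr>"
proof -
  have "(1\<^sub>m 2 :: scalar mat) = mat_of_rows_list 2 [[1, 0], [0, 1]]"
    by (simp add: one_mat_def mat_eq_mat_of_rows_list[of 2] upto_small)
  then show ?thesis
    unfolding tensor_module_def Vmod_1[OF assms] uq_module.simps
    by (simp add: kron_2_2 add_mat_of_rows_list)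
qed

text \<open>The inclusions of \<open>V\<^sub>0\<close> and \<open>V\<^sub>2\<close> in \<open>V\<^sub>1 \<otimes> V\<^sub>1\<close> and the projections, on the basis
  \<open>v\<^sub>0 \<otimes> v\<^sub>0\<close>, \<open>v\<^sub>0 \<otimes> v\<^sub>1\<close>, \<open>v\<^sub>1 \<otimes> v\<^sub>0\<close>, \<open>v\<^sub>1 \<otimes> v\<^sub>1\<close>.\<close>

definition incl_0 :: "nat \<Rightarrow> scalar mat" where
  "incl_0 k = mat_of_rows_list 1 [[0], [qq k], [- 1], [0]]"

definition proj_0 :: "nat \<Rightarrow> scalar mat" where
  "proj_0 k = mat_of_rows_list 4 [[0, inverse (qint k 2), - inverse (qq k * qint k 2), 0]]"

definition incl_2 :: "nat \<Rightarrow> scalar mat" where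
  "incl_2 k = mat_of_rows_list 3 [[1, 0, 0], [0, inverse (qq k), 0], [0, 1, 0], [0, 0, 1]]"

definition proj_2 :: "nat \<Rightarrow> scalar mat" where
  "proj_2 k = mat_of_rows_list 4
     [[1, 0, 0, 0], [0, inverse (qint k 2), qq k * inverse (qint k 2), 0], [0, 0, 0, 1]]"

lemma mat_of_rows_list_in_carrier:
  "length rs = nr \<Longrightarrow> mat_of_rows_list nc rs \<in> carrier_mat nr nc"
  unfolding mat_of_rows_list_def by (metis mat_carrier)

text \<open>The columns of \<open>incl_2\<close> are the vectors \<open>F\<close>^(i) (v_0 \<otimes>
  v_0), and the column of \<open>incl_0\<close> is killed by \<open>E\<close> and \<open>F\<close>.
  The denominators [2] of the projections come from [2] = q + 1/q, which makes the two idempotents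
  add up to the identity.\<close>

lemma
  assumes "k > 0"
  shows intertwiner_incl_0: "intertwiner (Vmod k 0) (tensor_module (Vmod k 1) (Vmod k 1)) (incl_0 k)"
    and intertwiner_incl_2: "intertwiner (Vmod k 2) (tensor_module (Vmod k 1) (Vmod k 1)) (incl_2 k)"
    and intertwiner_proj_0: "intertwiner (tensor_module (Vmod k 1) (Vmod k 1)) (Vmod k 0) (proj_0 k)"
    and intertwiner_proj_2: "intertwiner (tensor_module (Vmod k 1) (Vmod k 1)) (Vmod k 2) (proj_2 k)"
    and incl_proj_sum: "incl_0 k * proj_0 k + incl_2 k * proj_2 k = 1\<^sub>m 4"
proof -
  define z d where "z = qq k" and "d = qint k 2"
  have nz: "z \<noteq> 0" "d \<noteq> 0" "z * d \<noteq> 0"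
    using qint_nonzero[OF assms, of 2] by (simp_all add: z_def d_def)
  have zd: "inverse z + z = d" "z + inverse z = d"
    unfolding z_def d_def qint_2[OF assms] by (simp_all add: add.commute)
  note mods = tensor_Vmod_1[OF assms] Vmod_2[OF assms] Vmod_0 uq_module.simps
    intertwiner_def incl_0_def incl_2_def proj_0_def proj_2_def d_def[symmetric] z_def[symmetric]
  note comp = mult_mat_of_rows_list upto_small mat_of_rows_list_in_carrier nz zd
  show "intertwiner (Vmod k 0) (tensor_module (Vmod k 1) (Vmod k 1)) (incl_0 k)"
    unfolding mods by (simp add: comp)
  show "intertwiner (Vmod k 2) (tensor_module (Vmod k 1) (Vmod k 1)) (incl_2 k)"
    unfolding mods by (simp add: comp)
  show "intertwiner (tensor_module (Vmod k 1) (Vmod k 1)) (Vmod k 0) (proj_0 k)"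
    unfolding mods by (simp add: comp)
  \<comment> \<open>The relation 1/z + z = d divided by \<open>d\<close>, in the orders of factors
    met below.\<close>
  have e: "inverse d * inverse z + z * inverse d = 1" "d * (z * inverse d) = z"
    "inverse z * inverse d + z * inverse d = 1" "z * inverse d + inverse z * inverse d = 1"
    using nz arg_cong[OF zd(1), of "(*) (inverse d)"] by (simp_all add: algebra_simps)
  show "intertwiner (tensor_module (Vmod k 1) (Vmod k 1)) (Vmod k 2) (proj_2 k)"
    unfolding mods by (simp add: comp e)
  show "incl_0 k * proj_0 k + incl_2 k * proj_2 k = 1\<^sub>m 4"
    unfolding mods by (simp add: comp e add_mat_of_rows_list one_mat_def mat_eq_mat_of_rows_list)
qed

section \<open>The element \<open>X\<close> on the two smallest modules\<close>

lemma X_elt_carrier: "X_elt k n \<in> carrier_mat (n + 1) (n + 1)"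
  unfolding X_elt_def uhat_mult_def J_elt_def T_elt_def
  by (rule mult_carrier_mat[OF mat_carrier mat_carrier])

lemma divpow_0: "A \<in> carrier_mat n n \<Longrightarrow> divpow k A 0 = 1\<^sub>m n"
  by (auto simp: divpow_def qfact_def)

lemma divpow_1: "k > 0 \<Longrightarrow> A \<in> carrier_mat n n \<Longrightarrow> divpow k A 1 = A"
  using qint_1[of k] by (auto simp: divpow_def qfact_def)

lemma qpow_0: "qpow k 0 = 1"
  by (simp add: qpow_def)

text \<open>The index set is a separate variable \<open>S\<close>, so that an explicit list of
  triples can be substituted for each weight.\<close>

lemma T_elt_entry:
  assumes "i \<le> n" "j \<le> n"
    and "{(a, b, c). a \<le> n \<and> b \<le> n \<and> c \<le> n \<and> - int a + int b - int c = int n - 2 * int j} = S"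
  shows "T_elt k n $$ (i, j) = (\<Sum>(a, b, c)\<in>S. (- 1) ^ b * qq k powi (int b - int a * int c) *
    (divpow k (opE (Vmod k n)) a * divpow k (opF (Vmod k n)) b * divpow k (opE (Vmod k n)) c) $$ (i, j))"
  unfolding assms(3)[symmetric] using assms(1,2) by (simp add: T_elt_def)

lemma X_elt_0: "X_elt k 0 = 1\<^sub>m 1"
proof -
  have *: "{(a, b, c). a \<le> 0 \<and> b \<le> 0 \<and> c \<le> 0 \<and> - int a + int b - int c = int 0 - 2 * int 0}
      = {(0, 0, 0)}"
    by auto
  have "T_elt k 0 $$ (0, 0) = 1"
    using divpow_0[OF Vmod_carrier(2), of k k 0] divpow_0[OF Vmod_carrier(3), of k k 0]
    by (simp add: T_elt_entry[OF _ _ *])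
  then have "T_elt k 0 = 1\<^sub>m 1"
    by (intro eq_matI) (simp_all add: T_elt_def)
  moreover have "J_elt k 0 = 1\<^sub>m 1"
    by (rule eq_matI) (simp_all add: J_elt_def wt_form_def qpow_0)
  ultimately show ?thesis
    by (simp add: X_elt_def uhat_mult_def)
qed

text \<open>On v_0, of weight 1, only the term - q \<open>F\<close> occurs. On v_1, of weight -1,
  the sum is \<open>E\<close> + \<open>E\<close> - \<open>E F E\<close>, which is \<open>E\<close>
  because \<open>E F E\<close> = \<open>E\<close> on V_1.\<close>

lemma T_elt_1:
  assumes "k > 0"
  shows "T_elt k 1 = mat_of_rows_list 2 [[0, 1], [- qq k, 0]]"
proof -
  have 0: "{(a, b, c). a \<le> 1 \<and> b \<le> 1 \<and> c \<le> 1 \<and> - int a + int b - int c = int 1 - 2 * int 0}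
      = {(0, 1, 0)}"
    by auto
  have 1: "{(a, b, c). a \<le> 1 \<and> b \<le> 1 \<and> c \<le> 1 \<and> - int a + int b - int c = int 1 - 2 * int 1}
      = {(1, 0, 0), (0, 0, 1), (1, 1, 1)}"
    by (auto simp: le_Suc_eq)
  have one: "(1\<^sub>m 2 :: scalar mat) = mat_of_rows_list 2 [[1, 0], [0, 1]]"
    by (simp add: one_mat_def mat_eq_mat_of_rows_list[of 2] upto_small)
  have d: "divpow k (opE (Vmod k 1)) 0 = mat_of_rows_list 2 [[1, 0], [0, 1]]"
    "divpow k (opF (Vmod k 1)) 0 = mat_of_rows_list 2 [[1, 0], [0, 1]]"
    "divpow k (opE (Vmod k 1)) 1 = mat_of_rows_list 2 [[0, 1], [0, 0]]"
    "divpow k (opF (Vmod k 1)) 1 = mat_of_rows_list 2 [[0, 0], [1, 0]]"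
    unfolding Vmod_1[OF assms] uq_module.simps
    by (simp_all add: divpow_0[of _ 2] divpow_1[of _ _ 2, simplified] assms one
        mat_of_rows_list_in_carrier)
  have "T_elt k 1 $$ (i, 0) = - qq k * mat_of_rows_list 2 [[0, 0], [1, 0]] $$ (i, 0)"
    "T_elt k 1 $$ (i, 1) = mat_of_rows_list 2 [[0, 1], [0, 0]] $$ (i, 1)"
    if "i = 0 \<or> i = 1" for i
    using that T_elt_entry[OF _ _ 0, of i k] T_elt_entry[OF _ _ 1, of i k]
    by (auto simp: d mult_mat_of_rows_list upto_small simp del: One_nat_def)
  moreover have "T_elt k 1 \<in> carrier_mat 2 2"
    by (simp add: T_elt_def numeral_2_eq_2)
  ultimately show ?thesis
    by (subst mat_2_eq_mat_of_rows_list) (simp_all add: mat_of_rows_list_def)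
qed

text \<open>The weights 1 and -1 give the exponents 1/4 + 1/2 and 1/4 - 1/2. With k = 4l the power
  q^(1/4) is \<open>qroot ^ l\<close>.\<close>

lemma J_elt_1:
  "J_elt (4 * l) 1 = mat_of_rows_list 2 [[qroot ^ (3 * l), 0], [0, inverse (qroot ^ l)]]"
proof -
  have "\<lfloor>rat_of_nat (4 * l) * (3 / 4)\<rfloor> = int (3 * l)" "\<lfloor>rat_of_nat (4 * l) * (- (1 / 4))\<rfloor> = - int l"
    by (simp_all add: floor_eq_iff)
  then have "qpow (4 * l) (3 / 4) = qroot ^ (3 * l)" "qpow (4 * l) (- (1 / 4)) = inverse (qroot ^ l)"
    unfolding qpow_def by (simp_all only: power_int_of_nat power_int_minus)
  then show ?thesis
    by (simp add: J_elt_def mat_eq_mat_of_rows_list[of "Suc (Suc 0)"] numeral_2_eq_2 wt_form_def rho_def)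
qed

lemma X_elt_1:
  assumes "l > 0"
  shows "X_elt (4 * l) 1 = mat_of_rows_list 2 [[0, qroot ^ (3 * l)], [- (qroot ^ (3 * l)), 0]]"
proof -
  \<comment> \<open>This is q^(-1/4) q = q^(3/4): the antidiagonal entries of \<open>X\<close>
    become opposite, so its square is - q^(3/2).\<close>
  have "inverse (qroot ^ l) * qroot ^ (4 * l) = qroot ^ (3 * l)"
    by (simp add: field_simps flip: power_add)
  then show ?thesis
    using T_elt_1[of "4 * l"] J_elt_1[of l] assms
    by (simp add: X_elt_def uhat_mult_def mult_mat_of_rows_list upto_small)
qed

text \<open>The exponent is - 1/2 - 1 = - 3/2, written through q^(3/4) to be compared with the
  square of the inverse of \<open>X\<close>, which is the negative of this matrix.\<close>

lemma C_elt_1: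
  "C_elt (4 * l) 1 = mat_of_rows_list 2
     [[inverse ((qroot ^ (3 * l)) ^ 2), 0], [0, inverse ((qroot ^ (3 * l)) ^ 2)]]"
proof -
  have "\<lfloor>rat_of_nat (4 * l) * (- (3 / 2))\<rfloor> = - int (3 * l * 2)"
    by (simp add: floor_eq_iff)
  then have "qpow (4 * l) (- (3 / 2)) = inverse ((qroot ^ (3 * l)) ^ 2)"
    unfolding qpow_def by (simp only: power_int_of_nat power_int_minus power_mult)
  then show ?thesis
    by (subst mat_2_eq_mat_of_rows_list) (simp_all add: C_elt_def wt_form_def rho_def numeral_2_eq_2)
qed

section \<open>Half-ribbon elements\<close>

lemma uhat_inv_eq:
  assumes "x n \<in> carrier_mat (n + 1) (n + 1)" "y \<in> carrier_mat (n + 1) (n + 1)"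
    and "x n * y = 1\<^sub>m (n + 1)" "y * x n = 1\<^sub>m (n + 1)"
  shows "uhat_inv x n = y"
proof -
  interpret ring "End_V n"
    unfolding End_V_def by (rule ring_mat)
  show ?thesis
    unfolding uhat_inv_def
    by (rule inv_char) (use assms in \<open>auto simp: End_V_def ring_mat_simps\<close>)
qed

lemma uhat_units_carrier:
  assumes "t \<in> uhat_units"
  shows "t n \<in> carrier_mat (n + 1) (n + 1)" "uhat_inv t n \<in> carrier_mat (n + 1) (n + 1)"
    "uhat_inv t n * t n = 1\<^sub>m (n + 1)"
proof -
  interpret ring "End_V n"
    unfolding End_V_def by (rule ring_mat)
  have t: "t n \<in> Units (End_V n)"
    using assms by (simp add: uhat_units_def)
  show "t n \<in> carrier_mat (n + 1) (n + 1)" "uhat_inv t n \<in> carrier_mat (n + 1) (n + 1)"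
    "uhat_inv t n * t n = 1\<^sub>m (n + 1)"
    using Units_closed[OF t] Units_inv_closed[OF t] Units_l_inv[OF t]
    by (simp_all add: uhat_inv_def End_V_def ring_mat_simps)
qed

lemma mat_of_rows_list_eqD:
  assumes "mat_of_rows_list m A = mat_of_rows_list m B" "i < length B" "j < m"
  shows "A ! i ! j = B ! i ! j"
proof -
  have "length A = length B"
    using arg_cong[OF assms(1), of dim_row] by (simp add: mat_of_rows_list_def)
  then show ?thesis
    using arg_cong[OF assms(1), of "\<lambda>A. A $$ (i, j)"] assms(2,3) by (simp add: mat_of_rows_list_def)
qed

text \<open>The column \<open>incl_0 k\<close> is a homomorphism from V_0, so \<Delta>x acts on it
  through \<open>x 0\<close>. This is applied both to \<open>t\<close> and to
  \<open>X\<close>.\<close>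

lemma coprod_singular_vector:
  assumes k: "k > 0" and x: "\<And>n. x n \<in> carrier_mat (n + 1) (n + 1)" and x0: "x 0 = 1\<^sub>m 1"
  shows "coprod k x 1 1 \<in> carrier_mat 4 4" "coprod k x 1 1 * incl_0 k = incl_0 k"
proof -
  let ?M = "tensor_module (Vmod k 1) (Vmod k 1)"
  have dim: "rdim ?M = 4"
    by (simp only: tensor_Vmod_1[OF k] uq_module.simps)
  have M: "is_uq_module k ?M"
    by (intro tensor_module_is_uq_module Vmod_is_uq_module k)
  note * = act_intertwiner[OF k M x intertwiner_incl_0[OF k] intertwiner_incl_2[OF k]
      intertwiner_proj_0[OF k] intertwiner_proj_2[OF k], unfolded dim, OF incl_proj_sum[OF k]]
  show "coprod k x 1 1 \<in> carrier_mat 4 4"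
    using *(1) by (simp add: coprod_def)
  have "incl_0 k \<in> carrier_mat 4 1"
    by (simp add: incl_0_def mat_of_rows_list_in_carrier)
  then show "coprod k x 1 1 * incl_0 k = incl_0 k"
    using *(2)[OF intertwiner_incl_0[OF k]] by (simp add: coprod_def x0)
qed

text \<open>On V_0 \<otimes> V_0 the equation is one between scalars with right side 1. If
  \<open>t\<close> is a and its inverse b, then b b a = 1 and b a = 1, hence b = 1 and a =
  1.\<close>

lemma half_ribbon_0:
  assumes k: "k > 0" and t: "t \<in> uhat_units"
    and R: "uhat2_mult (uhat_tensor (uhat_inv t) (uhat_inv t)) (coprod k t) = R_elt k"
  shows "t 0 = 1\<^sub>m 1"
proof -
  have inv_X: "uhat_inv (X_elt k) 0 = 1\<^sub>m 1"
    by (rule uhat_inv_eq) (simp_all add: X_elt_0)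
  have cop: "coprod k x 0 0 = x 0" if "\<And>n. x n \<in> carrier_mat (n + 1) (n + 1)" for x
    unfolding coprod_def tensor_Vmod_0 by (rule act_Vmod[OF k that])
  note tC = uhat_units_carrier[OF t]
  define a where "a = t 0 $$ (0, 0)"
  define b where "b = uhat_inv t 0 $$ (0, 0)"
  have ab: "t 0 = mat_of_rows_list 1 [[a]]" "uhat_inv t 0 = mat_of_rows_list 1 [[b]]"
    using tC(1)[of 0] tC(2)[of 0] by (auto intro!: eq_matI simp: a_def b_def mat_of_rows_list_def)
  have "kron (uhat_inv t 0) (uhat_inv t 0) * t 0 = kron (1\<^sub>m 1) (1\<^sub>m 1) * 1\<^sub>m 1"
    using fun_cong[OF fun_cong[OF R, of 0], of 0]
    by (simp add: uhat2_mult_def uhat_tensor_def R_elt_def inv_X X_elt_0 cop tC(1)[simplified]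
        X_elt_carrier[simplified])
  from arg_cong[OF this, of "\<lambda>A. A $$ (0, 0)"] have "b * b * a = 1"
    by (simp add: ab kron_def mat_of_rows_list_def scalar_prod_def)
  moreover from arg_cong[OF tC(3)[of 0], of "\<lambda>A. A $$ (0, 0)"] have "b * a = 1"
    by (simp add: ab mat_of_rows_list_def scalar_prod_def)
  ultimately have "a = 1"
    by (metis mult.assoc mult.right_neutral mult_1)
  then show ?thesis
    by (simp add: ab one_mat_def mat_eq_mat_of_rows_list)
qed

text \<open>Here \<open>z\<close> is the quantum parameter, and \<open>p\<close>, \<open>q\<close>,
  \<open>r\<close>, \<open>s\<close> are the entries of S. Adding \<open>z\<close> times the second
  equation of \<open>form\<close> to the third gives p s = 0, so q r = - c. The first equation then
  forces p = 0, and \<open>square\<close> turns into q r = c, a contradiction.\<close>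

lemma no_two_by_two_solution:
  fixes z c p q r s :: "'a :: field"
  assumes two: "(2 :: 'a) \<noteq> 0" and z: "z * z \<noteq> 1" and c: "c \<noteq> 0"
    and form: "z * (p * q) = q * p" "z * (p * s) - q * r = c" "z * (r * q) - s * p = - (c * z)"
    and square: "p * p + q * r = c"
  shows False
proof -
  have "(z * z - 1) * (p * s) = z * (z * (p * s) - q * r) + (z * (r * q) - s * p)"
    by (simp add: algebra_simps)
  then have "(z * z - 1) * (p * s) = 0"
    unfolding form(2,3) by simp
  then have qr: "q * r = - c"
    using z form(2) by auto
  have "(z - 1) * (p * q) = 0"
    using form(1) by (simp add: algebra_simps)
  then have "p = 0"
    using z qr c by auto
  then have *: "q * r = c"
    using square by simp
  have "2 * c = c - q * r"
    unfolding qr by simp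
  then have "2 * c = 0"
    unfolding * by simp
  then show False
    using two c by simp
qed

lemma two_scalar_neq_0: "(2 :: scalar) \<noteq> 0"
proof -
  have "(2 :: scalar) = Fract 2 1"
    using Fract_of_nat_eq[of 2, where ?'a = "complex poly"] by simp
  also have "\<dots> \<noteq> 0"
    by (simp add: Zero_fract_def eq_fract)
  finally show ?thesis .
qed

theorem theorem5p17:
  fixes k :: nat
  assumes "k > 0" and "4 dvd k"
  shows "\<not> (\<exists>t \<in> uhat_units.
    uhat2_mult (uhat_tensor (uhat_inv t) (uhat_inv t)) (coprod k t) = R_elt k \<and>
    uhat_mult (uhat_inv t) (uhat_inv t) = C_elt k)"
proof
  assume "\<exists>t \<in> uhat_units.
    uhat2_mult (uhat_tensor (uhat_inv t) (uhat_inv t)) (coprod k t) = R_elt k \<and>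
    uhat_mult (uhat_inv t) (uhat_inv t) = C_elt k"
  then obtain t where t: "t \<in> uhat_units"
    and R: "uhat2_mult (uhat_tensor (uhat_inv t) (uhat_inv t)) (coprod k t) = R_elt k"
    and C: "uhat_mult (uhat_inv t) (uhat_inv t) = C_elt k"
    by blast
  obtain l where l: "k = 4 * l" "l > 0"
    using assms by (auto elim!: dvdE)
  note tC = uhat_units_carrier[OF t]
  \<comment> \<open>This is q^(3/4), the upper right entry of \<open>X\<close> on V_1.\<close>
  define w where "w = qroot ^ (3 * l)"
  have w: "w \<noteq> 0"
    by (simp add: w_def)
  have X: "X_elt k 1 = mat_of_rows_list 2 [[0, w], [- w, 0]]"
    unfolding l(1) w_def by (rule X_elt_1[OF l(2)])
  define Y where "Y = mat_of_rows_list 2 [[0, - inverse w], [inverse w, 0]]"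
  have one: "(1\<^sub>m 2 :: scalar mat) = mat_of_rows_list 2 [[1, 0], [0, 1]]"
    by (simp add: one_mat_def mat_eq_mat_of_rows_list[of 2] upto_small)
  have Y: "uhat_inv (X_elt k) 1 = Y"
  proof (rule uhat_inv_eq)
    have "(1::nat) + 1 = 2"
      by simp
    then show "X_elt k 1 \<in> carrier_mat (1 + 1) (1 + 1)" "Y \<in> carrier_mat (1 + 1) (1 + 1)"
      "X_elt k 1 * Y = 1\<^sub>m (1 + 1)" "Y * X_elt k 1 = 1\<^sub>m (1 + 1)"
      unfolding X Y_def using w
      by (simp_all only: one mat_of_rows_list_in_carrier)
        (simp_all add: mat_of_rows_list_in_carrier mult_mat_of_rows_list upto_small)
  qed
  define S where "S = uhat_inv t 1"
  have SC: "S \<in> carrier_mat 2 2"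
    using tC(2)[of 1] by (simp add: S_def numeral_2_eq_2)
  obtain p q r s where S: "S = mat_of_rows_list 2 [[p, q], [r, s]]"
    using mat_2_eq_mat_of_rows_list[OF SC] by blast
  have kronC: "kron A A \<in> carrier_mat 4 4" if "A \<in> carrier_mat 2 2" for A
    using kron_carrier[OF that that] by simp
  have incl_C: "incl_0 k \<in> carrier_mat 4 1"
    by (simp add: incl_0_def mat_of_rows_list_in_carrier)
  have YC: "Y \<in> carrier_mat 2 2"
    by (simp add: Y_def mat_of_rows_list_in_carrier)
  note ct = coprod_singular_vector[OF assms(1) tC(1) half_ribbon_0[OF assms(1) t R]]
  note cX = coprod_singular_vector[OF assms(1) X_elt_carrier X_elt_0]
  \<comment> \<open>Insert \<Delta>t, which fixes the vector, replace the product by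
    \<open>R\<close>, and remove \<Delta>X, which fixes the vector too.\<close>
  have "kron S S * incl_0 k = kron S S * coprod k t 1 1 * incl_0 k"
    using assoc_mult_mat[OF kronC[OF SC] ct(1) incl_C] ct(2) by simp
  also have "\<dots> = kron Y Y * coprod k (X_elt k) 1 1 * incl_0 k"
    using fun_cong[OF fun_cong[OF R, of 1], of 1]
    by (simp only: uhat2_mult_def uhat_tensor_def R_elt_def S_def Y)
  also have "\<dots> = kron Y Y * incl_0 k"
    using assoc_mult_mat[OF kronC[OF YC] cX(1) incl_C] cX(2) by simp
  finally have form: "kron S S * incl_0 k = kron Y Y * incl_0 k" .
  \<comment> \<open>The scalar q^(-3/2) by which \<open>C\<close> acts on V_1; the antidiagonal
    entries of \<open>Y\<close> have product - c.\<close>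
  define c where "c = inverse (w ^ 2)"
  have YY: "kron Y Y * incl_0 k = mat_of_rows_list 1 [[0], [c], [- (c * qq k)], [0]]"
    by (simp add: Y_def incl_0_def kron_2_2 mult_mat_of_rows_list c_def power2_eq_square)
  have SS: "kron S S * incl_0 k = mat_of_rows_list 1
      [[p * q * qq k - q * p], [p * s * qq k - q * r], [r * q * qq k - s * p], [r * s * qq k - s * r]]"
    by (simp add: S incl_0_def kron_2_2 mult_mat_of_rows_list)
  note eq = mat_of_rows_list_eqD[OF form[unfolded SS YY]]
  have square: "S * S = mat_of_rows_list 2 [[c, 0], [0, c]]"
    using fun_cong[OF C, of 1] C_elt_1[of l]
    by (simp add: uhat_mult_def S_def l(1) c_def w_def)
  have SS2: "S * S = mat_of_rows_list 2
      [[p * p + q * r, p * q + q * s], [r * p + s * r, r * q + s * s]]"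
    by (simp add: S mult_mat_of_rows_list upto_small)
  have "p * p + q * r = c"
    \<comment> \<open>The upper left entry of S S = \<open>C\<close>.\<close>
    using mat_of_rows_list_eqD[OF square[unfolded SS2], of 0 0] by simp
  moreover have "qq k * qq k \<noteq> 1"
    using qroot_power_neq_1[of "k + k"] assms(1) by (simp add: power_add)
  moreover have "c \<noteq> 0"
    using w by (simp add: c_def)
  \<comment> \<open>The first three coordinates of \<open>form\<close> enter. The instantiation
    follows the order in which the variables first occur in the lemma, where \<open>s\<close>
    precedes \<open>r\<close>.\<close>
  ultimately show False
    using two_scalar_neq_0 eq[of 0 0] eq[of 1 0] eq[of 2 0]
    by (intro no_two_by_two_solution[of "qq k" c p q s r]) (simp_all add: algebra_simps)
qed

end
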